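(* Let $X$ be the Dynkin diagram of a symmetrizable generalized Cartan matrix $A=(a_{ij})_{1\le i,j\le n}$ with simple roots $\alpha_1,\dots,\alpha_n$. Suppose $p\ne q$ are vertices of $X$ with $a_{qp}=-1$ and $a_{pq}=-c$, where either (i) $c=2$ (so $p,q$ form a subdiagram of type $B_2$), or (ii) $c=3$ (so $p,q$ form a subdiagram of type $G_2$), or (iii) $c=4$ (so $p,q$ form a subdiagram of type $A_2^{(2)}$). Put $\beta_p=s_p(\alpha_q)=\alpha_q+c\,\alpha_p$ and $\beta_j=\alpha_j$ for all $j\neq p$. Then $\{\beta_i : 1\le i\le n\}$ is a $\pi$-system in $X$, and its type $B=(b_{ij})$ satisfies $$b_{jp}=a_{jq}+c\,a_{jp},\qquad b_{pj}=a_{qj}+a_{pj}\qquad (j\ne p),$$ and $b_{ij}=a_{ij}$ for all $i,j\ne p$. In particular, $b_{pq}=b_{qp}=0$ in case (i), $b_{pq}=b_{qp}=-1$ in case (ii), and $b_{pq}=b_{qp}=-2$ in case (iii).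
   Context: $s_p$ is the simple reflection associated to $\alpha_p$. A $\pi$-system in $X$ is a finite set of distinct real roots $\{\beta_i\}$ of the Kac-Moody algebra of $X$ such that $\beta_i-\beta_j$ is not a root for any $i\ne j$. Its type is the generalized Cartan matrix $B=(b_{ij})$ with $b_{ij}=\langle\beta_i^\vee,\beta_j\rangle$, where $\beta^\vee$ denotes the coroot of the real root $\beta$; here $a_{ij}=\langle\alpha_i^\vee,\alpha_j\rangle$. *)

theory Defs
  imports "HOL-Analysis.Analysis"
begin

definition gcm :: "int^'n^'n \<Rightarrow> bool" where
  "gcm A \<longleftrightarrow> (\<forall>i. A $ i $ i = 2) \<and> (\<forall>i j. i \<noteq> j \<longrightarrow> A $ i $ j \<le> 0) \<and>
     (\<forall>i j. A $ i $ j = 0 \<longrightarrow> A $ j $ i = 0)"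

text \<open>The diagonal of an invertible diagonal matrix \<open>D\<close> with \<open>D A\<close> symmetric.\<close>

definition symmetrizable :: "int^'n^'n \<Rightarrow> bool" where
  "symmetrizable A \<longleftrightarrow> (\<exists>d :: 'n \<Rightarrow> real. (\<forall>i. d i \<noteq> 0) \<and>
     (\<forall>i j. d i * of_int (A $ i $ j) = d j * of_int (A $ j $ i)))"

locale lie_algebra = vector_space scale
  for scale :: "complex \<Rightarrow> 'g::ab_group_add \<Rightarrow> 'g" +
  fixes bracket :: "'g \<Rightarrow> 'g \<Rightarrow> 'g"
  assumes bracket_linear_left: "Vector_Spaces.linear scale scale (\<lambda>x. bracket x y)"
    and bracket_linear_right: "Vector_Spaces.linear scale scale (\<lambda>y. bracket x y)"
    and bracket_self: "bracket x x = 0"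
    and jacobi: "bracket x (bracket y z) + bracket y (bracket z x) + bracket z (bracket x y) = 0"
begin

definition lie_subalgebra :: "'g set \<Rightarrow> bool" where
  "lie_subalgebra U \<longleftrightarrow> subspace U \<and> (\<forall>x\<in>U. \<forall>y\<in>U. bracket x y \<in> U)"

definition lie_ideal :: "'g set \<Rightarrow> bool" where
  "lie_ideal I \<longleftrightarrow> subspace I \<and> (\<forall>x. \<forall>y\<in>I. bracket x y \<in> I)"

end

text \<open>
  A complex Lie algebra on the type \<open>'g\<close> with Cartan subalgebra the image of the vector space
  \<open>'h\<close> under \<open>cartan\<close>. The dual of \<open>'h\<close> consists of the linear maps \<open>'h \<Rightarrow> complex\<close>.
\<close>

record ('n, 'h, 'g) km_data =
  h_scale :: "complex \<Rightarrow> 'h \<Rightarrow> 'h"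
  g_scale :: "complex \<Rightarrow> 'g \<Rightarrow> 'g"
  bracket :: "'g \<Rightarrow> 'g \<Rightarrow> 'g"
  cartan :: "'h \<Rightarrow> 'g"
  simple_root :: "'n \<Rightarrow> 'h \<Rightarrow> complex"
  simple_coroot :: "'n \<Rightarrow> 'h"
  gen_e :: "'n \<Rightarrow> 'g"
  gen_f :: "'n \<Rightarrow> 'g"

text \<open>
  The Kac-Moody algebra of \<open>A\<close> is the largest quotient of the Lie algebra generated by \<open>'h\<close>,
  \<open>gen_e i\<close>, \<open>gen_f i\<close> subject to the four relations below in which \<open>'h\<close> still embeds, i.e. the
  quotient by the maximal ideal that meets \<open>'h\<close> trivially (Kac, Infinite dimensional Lie
  algebras, 1.1-1.4). It is described here by the properties that determine it up to isomorphism: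
  generation, the relations, and the absence of nonzero ideals meeting \<open>'h\<close> trivially.
\<close>

locale kac_moody_algebra =
  H: vector_space "h_scale K" + G: lie_algebra "g_scale K" "bracket K"
  for A :: "int^'n^'n"
    and K :: "('n::finite, 'h::ab_group_add, 'g::ab_group_add) km_data" +
  assumes gcm: "gcm A"
    \<comment> \<open>\<open>'h\<close> with the simple roots and coroots is a realization of \<open>A\<close>\<close>
    and h_finite_dim: "\<exists>S. finite S \<and> H.span S = UNIV"
    and h_dim: "H.dim UNIV + rank (\<chi> i j. complex_of_int (A $ i $ j)) = 2 * CARD('n)"
    and simple_root_linear: "Vector_Spaces.linear (h_scale K) (*) (simple_root K i)"
    and simple_root_indep:
      "(\<And>h. (\<Sum>i\<in>UNIV. a i * simple_root K i h) = 0) \<Longrightarrow> a i = 0"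
    and simple_coroot_indep:
      "(\<Sum>i\<in>UNIV. h_scale K (a i) (simple_coroot K i)) = 0 \<Longrightarrow> a i = 0"
    and cartan_matrix: "simple_root K j (simple_coroot K i) = of_int (A $ i $ j)"
    and cartan_linear: "Vector_Spaces.linear (h_scale K) (g_scale K) (cartan K)"
    and cartan_inj: "inj (cartan K)"
    and cartan_abelian: "bracket K (cartan K h) (cartan K h') = 0"
    and bracket_e_f:
      "bracket K (gen_e K i) (gen_f K j) = (if i = j then cartan K (simple_coroot K i) else 0)"
    and bracket_h_e: "bracket K (cartan K h) (gen_e K i) = g_scale K (simple_root K i h) (gen_e K i)"
    and bracket_h_f: "bracket K (cartan K h) (gen_f K i) = g_scale K (- simple_root K i h) (gen_f K i)"
    and generated:
      "G.lie_subalgebra U \<Longrightarrow> range (cartan K) \<union> range (gen_e K) \<union> range (gen_f K) \<subseteq> U \<Longrightarrow> U = UNIV"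
    and no_ideal: "G.lie_ideal I \<Longrightarrow> I \<inter> range (cartan K) = {0} \<Longrightarrow> I = {0}"

definition is_root :: "('n, 'h::ab_group_add, 'g::ab_group_add) km_data \<Rightarrow> ('h \<Rightarrow> complex) \<Rightarrow> bool" where
  "is_root K \<mu> \<longleftrightarrow> Vector_Spaces.linear (h_scale K) (*) \<mu> \<and> (\<exists>h. \<mu> h \<noteq> 0) \<and>
     (\<exists>x. x \<noteq> 0 \<and> (\<forall>h. bracket K (cartan K h) x = g_scale K (\<mu> h) x))"

definition reflection ::
    "('n, 'h, 'g) km_data \<Rightarrow> 'n \<Rightarrow> ('h \<Rightarrow> complex) \<Rightarrow> ('h \<Rightarrow> complex)" where
  "reflection K i \<mu> = (\<lambda>h. \<mu> h - \<mu> (simple_coroot K i) * simple_root K i h)"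

definition coreflection :: "('n, 'h::ab_group_add, 'g) km_data \<Rightarrow> 'n \<Rightarrow> 'h \<Rightarrow> 'h" where
  "coreflection K i h = h - h_scale K (simple_root K i h) (simple_coroot K i)"

text \<open>
  Elements of the Weyl group are given by words in the simple reflections; a word acts on the dual
  of \<open>'h\<close> by \<open>weyl\<close> and contragrediently on \<open>'h\<close> by \<open>coweyl\<close>.
\<close>

definition weyl ::
    "('n, 'h, 'g) km_data \<Rightarrow> 'n list \<Rightarrow> ('h \<Rightarrow> complex) \<Rightarrow> ('h \<Rightarrow> complex)" where
  "weyl K w = foldr (reflection K) w"

definition coweyl :: "('n, 'h::ab_group_add, 'g) km_data \<Rightarrow> 'n list \<Rightarrow> 'h \<Rightarrow> 'h" where
  "coweyl K w = foldr (coreflection K) w"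

definition real_root ::
    "('n, 'h::ab_group_add, 'g::ab_group_add) km_data \<Rightarrow> ('h \<Rightarrow> complex) \<Rightarrow> bool" where
  "real_root K \<beta> \<longleftrightarrow> is_root K \<beta> \<and> (\<exists>w i. \<beta> = weyl K w (simple_root K i))"

text \<open>The coroot of \<open>w \<alpha>\<^sub>i\<close> is \<open>w \<alpha>\<^sub>i\<^sup>\<or>\<close>; it depends only on the real root \<open>w \<alpha>\<^sub>i\<close>.\<close>

definition coroot :: "('n, 'h::ab_group_add, 'g) km_data \<Rightarrow> ('h \<Rightarrow> complex) \<Rightarrow> 'h" where
  "coroot K \<beta> = (THE b. \<exists>w i. \<beta> = weyl K w (simple_root K i) \<and> b = coweyl K w (simple_coroot K i))"

definition pi_system ::
    "('n, 'h::ab_group_add, 'g::ab_group_add) km_data \<Rightarrow> ('m::finite \<Rightarrow> 'h \<Rightarrow> complex) \<Rightarrow> bool" where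
  "pi_system K \<beta> \<longleftrightarrow> inj \<beta> \<and> (\<forall>i. real_root K (\<beta> i)) \<and>
     (\<forall>i j. i \<noteq> j \<longrightarrow> \<not> is_root K (\<lambda>h. \<beta> i h - \<beta> j h))"

definition has_type ::
    "('n, 'h::ab_group_add, 'g) km_data \<Rightarrow> ('m::finite \<Rightarrow> 'h \<Rightarrow> complex) \<Rightarrow> int^'m^'m \<Rightarrow> bool" where
  "has_type K \<beta> B \<longleftrightarrow> gcm B \<and> (\<forall>i j. of_int (B $ i $ j) = \<beta> j (coroot K (\<beta> i)))"

end

(*
  The algebra is spanned by the Cartan subalgebra and by iterated brackets of the e_i alone or of the
  f_i alone, so every root is a nonnegative or a nonpositive combination of simple roots, and among
  the multiples of alpha_p only alpha_p and -alpha_p are roots.  Each difference of two of the beta_i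
  either has coefficients of both signs or equals c alpha_p or -c alpha_p with c >= 2.
  That beta_p = alpha_q + c alpha_p is a root follows from an sl_2-computation in the alpha_p-string
  through alpha_q.
*)
theory Submission imports Defs begin

text \<open>Generators, relations and an ideal condition are all that is given, so the decomposition
  behind the root combinatorics has to be derived. It comes from a normalizer: the elements that
  bracket a subspace into itself form a subalgebra, hence stability of a span under the generators
  is stability under the whole algebra. Independence of the simple roots then turns weights into
  integer vectors whose signs can be compared.

  That s_p(alpha_q) is a root is shown by exhibiting the root vector (ad e_p)^c e_q, which ad f_p
  carries back to e_q with nonzero factors.

  For the type, the coroot is a definite description over all presentations w alpha_i of the same
  root, and symmetrizability makes it unambiguous. Since a_qp = -1, the coroot of beta_p is the sum
  of the coroots of alpha_q and alpha_p. Hence b_pq = a_qq + a_pq and b_qp = a_qq + c a_qp are both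
  2 - c, which gives 0, -1, -2. The bound c >= 2 serves twice: it keeps c alpha_p from being a root
  and makes these entries nonpositive.\<close>

context lie_algebra
begin

section \<open>Weights and iterated brackets in a Lie algebra\<close>

lemma bracket_add_left: "bracket (x + y) z = bracket x z + bracket y z"
  by (rule module_hom.add[OF Vector_Spaces.linear.axioms(3)[OF bracket_linear_left]])

lemma bracket_add_right: "bracket x (y + z) = bracket x y + bracket x z"
  by (rule module_hom.add[OF Vector_Spaces.linear.axioms(3)[OF bracket_linear_right]])

lemma bracket_scale_left: "bracket (scale a x) y = scale a (bracket x y)"
  by (rule module_hom.scale[OF Vector_Spaces.linear.axioms(3)[OF bracket_linear_left]])

lemma bracket_scale_right: "bracket x (scale a y) = scale a (bracket x y)"
  by (rule module_hom.scale[OF Vector_Spaces.linear.axioms(3)[OF bracket_linear_right]])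

lemma bracket_zero_left [simp]: "bracket 0 y = 0"
  by (rule module_hom.zero[OF Vector_Spaces.linear.axioms(3)[OF bracket_linear_left]])

lemma bracket_zero_right [simp]: "bracket x 0 = 0"
  by (rule module_hom.zero[OF Vector_Spaces.linear.axioms(3)[OF bracket_linear_right]])

lemma bracket_minus_right: "bracket x (- y) = - bracket x y"
  by (rule module_hom.neg[OF Vector_Spaces.linear.axioms(3)[OF bracket_linear_right]])

lemma bracket_sum_right: "bracket x (\<Sum>i\<in>I. f i) = (\<Sum>i\<in>I. bracket x (f i))"
  by (rule module_hom.sum[OF Vector_Spaces.linear.axioms(3)[OF bracket_linear_right]])

lemma bracket_anticomm: "bracket x y = - bracket y x"
proof -
  have "bracket x y + bracket y x = 0"
    using bracket_self[of "x + y"] unfolding bracket_add_left bracket_add_right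
    by (simp add: bracket_self add.commute)
  then show ?thesis
    by (simp add: eq_neg_iff_add_eq_0)
qed

text \<open>The Jacobi identity in the form "ad x is a derivation", which lets an operator be moved
  past the first letter of a word.\<close>

lemma bracket_leibniz: "bracket x (bracket y z) = bracket (bracket x y) z + bracket y (bracket x z)"
proof -
  have "bracket x (bracket y z) - bracket y (bracket x z) - bracket (bracket x y) z = 0"
    using jacobi[of x y z] bracket_anticomm[of z x] bracket_anticomm[of z "bracket x y"]
    by (simp add: bracket_minus_right)
  then show ?thesis
    by (simp add: algebra_simps)
qed

lemma bracket_in_span:
  assumes "y \<in> span B" and "\<And>b. b \<in> B \<Longrightarrow> bracket x b \<in> span S"
  shows "bracket x y \<in> span S"
  using assms(1)
  by (induction rule: span_induct_alt)
    (auto simp: bracket_add_right bracket_scale_right intro: span_add span_scale span_zero assms(2))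

text \<open>Right-normed brackets. The innermost letter \<open>j\<close> is a separate argument, so
  that there is no empty word; the letters of the word are those of \<open>ws @ [j]\<close>.\<close>

abbreviation lie_word :: "('i \<Rightarrow> 'g) \<Rightarrow> 'i list \<Rightarrow> 'i \<Rightarrow> 'g" where
  "lie_word e ws j \<equiv> foldr (\<lambda>i. bracket (e i)) ws (e j)"

abbreviation lie_words :: "('i \<Rightarrow> 'g) \<Rightarrow> 'g set" where
  "lie_words e \<equiv> {lie_word e ws j |ws j. True}"

lemma weight_bracket:
  assumes "bracket h x = scale a x" and "bracket h y = scale b y"
  shows "bracket h (bracket x y) = scale (a + b) (bracket x y)"
  by (simp add: bracket_leibniz[of h x y] assms bracket_scale_left bracket_scale_right
      scale_left_distrib)

lemma weight_lie_word:
  assumes "\<And>i. bracket h (e i) = scale (a i) (e i)"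
  shows "bracket h (lie_word e ws j) = scale (\<Sum>i\<leftarrow>ws @ [j]. a i) (lie_word e ws j)"
  by (induction ws) (simp_all add: assms weight_bracket)

text \<open>The innermost bracket is [e_j, e_j] = 0. This is what excludes proper multiples of a
  simple root.\<close>

lemma lie_word_repeated:
  assumes "ws \<noteq> []" and "set ws \<subseteq> {j}"
  shows "lie_word e ws j = 0"
  using assms
proof (induction ws)
  case (Cons i ws)
  then show ?case
    by (cases "ws = []") (auto simp: bracket_self)
qed simp

lemma generator_in_lie_words: "e i \<in> lie_words e"
  using exI[of "\<lambda>ws. \<exists>j. e i = lie_word e ws j" "[]"] by auto

lemma bracket_generator_in_lie_words:
  assumes "x \<in> lie_words e"
  shows "bracket (e i) x \<in> lie_words e"
proof -
  obtain ws j where "x = lie_word e ws j"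
    using assms by blast
  then have "bracket (e i) x = lie_word e (i # ws) j"
    by simp
  then show ?thesis by blast
qed

lemma bracket_generator_stable:
  assumes weight: "\<And>h i. bracket (c h) (e i) = scale (a i h) (e i)"
    and x: "x \<in> span (range c \<union> lie_words e)"
  shows "bracket (e i) x \<in> span (range c \<union> lie_words e)"
proof (rule bracket_in_span[OF x])
  fix b assume "b \<in> range c \<union> lie_words e"
  then show "bracket (e i) b \<in> span (range c \<union> lie_words e)"
  proof
    assume "b \<in> range c"
    then obtain h where "b = c h" by blast
    then have "bracket (e i) b = - scale (a i h) (e i)"
      using bracket_anticomm[of "e i" b] weight by simp
    then show ?thesis
      by (simp only:) (intro span_neg span_scale span_base UnI2 generator_in_lie_words)
  next
    assume "b \<in> lie_words e"
    then show ?thesis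
      by (intro span_base UnI2 bracket_generator_in_lie_words)
  qed
qed

text \<open>By Leibniz, ad f_k either hits the first letter, leaving a Cartan element that acts on
  the remaining word by a scalar, or passes to the remaining word, where induction applies. The
  families \<open>e\<close> and \<open>f\<close> are abstract so that the same argument serves with
  raising and lowering generators exchanged.\<close>

lemma bracket_opposite_lie_word:
  assumes weight: "\<And>h i. bracket (c h) (e i) = scale (a i h) (e i)"
    and opposite: "\<And>i j. bracket (f i) (e j) \<in> range c"
  shows "bracket (f k) (lie_word e ws j) \<in> span (range c \<union> lie_words e)"
proof (induction ws)
  case Nil
  then show ?case
    using opposite by (auto intro: span_base)
next
  case (Cons i ws)
  obtain h where h: "bracket (f k) (e i) = c h"
    using opposite by blast
  have "bracket (f k) (lie_word e (i # ws) j) =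
      bracket (c h) (lie_word e ws j) + bracket (e i) (bracket (f k) (lie_word e ws j))"
    by (simp add: bracket_leibniz[of "f k" "e i"] h)
  moreover have "bracket (c h) (lie_word e ws j) \<in> span (range c \<union> lie_words e)"
    unfolding weight_lie_word[of "c h" e "\<lambda>i. a i h", OF weight]
    by (rule span_scale, rule span_base) blast
  ultimately show ?case
    using bracket_generator_stable[OF weight Cons.IH] by (simp add: span_add)
qed

text \<open>The operator ad(c h) - \<nu>_s(h) kills the summand x_s, rescales the others, and
  multiplies the whole sum by \<mu>(h) - \<nu>_s(h), which is nonzero for a suitable h. The summands
  therefore vary in the induction. The weights \<nu>_t may coincide with one another; only \<mu>
  must be avoided.\<close>

lemma weight_sum_eq_0:
  assumes "finite T"
    and "\<And>t h. t \<in> T \<Longrightarrow> bracket (c h) (x t) = scale (\<nu> t h) (x t)"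
    and "\<And>t. t \<in> T \<Longrightarrow> \<nu> t \<noteq> \<mu>"
    and "\<And>h. bracket (c h) (\<Sum>t\<in>T. x t) = scale (\<mu> h) (\<Sum>t\<in>T. x t)"
  shows "(\<Sum>t\<in>T. x t) = 0"
  using assms
proof (induction T arbitrary: x rule: finite_induct)
  case (insert s T)
  let ?s = "\<Sum>t\<in>insert s T. x t"
  obtain h where h: "\<nu> s h \<noteq> \<mu> h"
    using insert.prems(2)[of s] by auto
  have "scale (\<mu> h - \<nu> s h) ?s = bracket (c h) ?s - scale (\<nu> s h) ?s"
    by (simp only: insert.prems(3) scale_left_diff_distrib)
  also have "\<dots> = (\<Sum>t\<in>insert s T. scale (\<nu> t h - \<nu> s h) (x t))"
    unfolding bracket_sum_right scale_sum_right sum_subtractf[symmetric]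
    by (rule sum.cong) (simp_all add: insert.prems(1) scale_left_diff_distrib)
  also have "\<dots> = (\<Sum>t\<in>T. scale (\<nu> t h - \<nu> s h) (x t))"
    using insert.hyps by simp
  finally have eq: "scale (\<mu> h - \<nu> s h) ?s = (\<Sum>t\<in>T. scale (\<nu> t h - \<nu> s h) (x t))" .
  have "(\<Sum>t\<in>T. scale (\<nu> t h - \<nu> s h) (x t)) = 0"
  proof (rule insert.IH)
    show "bracket (c h') (scale (\<nu> t h - \<nu> s h) (x t)) =
        scale (\<nu> t h') (scale (\<nu> t h - \<nu> s h) (x t))" if "t \<in> T" for t h'
      using that by (simp add: bracket_scale_right insert.prems(1) mult.commute)
    show "\<nu> t \<noteq> \<mu>" if "t \<in> T" for t
      using that insert.prems(2) by simp
    show "bracket (c h') (\<Sum>t\<in>T. scale (\<nu> t h - \<nu> s h) (x t)) =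
        scale (\<mu> h') (\<Sum>t\<in>T. scale (\<nu> t h - \<nu> s h) (x t))" for h'
      unfolding eq[symmetric] bracket_scale_right insert.prems(3)
      by (simp add: mult.commute)
  qed
  then show ?case
    using eq h by (simp only: scale_eq_0_iff) simp
qed simp

text \<open>Weights of the algebra can thus be read off from any spanning set of weight vectors:
  otherwise \<open>weight_sum_eq_0\<close> would make \<open>x\<close> vanish.\<close>

lemma weight_of_spanning_set:
  assumes "x \<in> span B" and "x \<noteq> 0"
    and "\<And>h. bracket (c h) x = scale (\<mu> h) x"
    and "\<And>b. b \<in> B \<Longrightarrow> \<exists>\<nu>. \<forall>h. bracket (c h) b = scale (\<nu> h) b"
  shows "\<exists>b\<in>B. b \<noteq> 0 \<and> (\<forall>h. bracket (c h) b = scale (\<mu> h) b)"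
proof (rule ccontr)
  assume none: "\<not> ?thesis"
  from assms(1) obtain T r where T: "finite T" "T \<subseteq> B" "x = (\<Sum>b\<in>T. scale (r b) b)"
    unfolding span_explicit by blast
  \<comment> \<open>The zero vector has every weight, so the weight chosen for it might be \<mu>; it
    is removed before the weights are compared.\<close>
  define T' where "T' = T - {0}"
  have x: "x = (\<Sum>b\<in>T'. scale (r b) b)"
    unfolding T(3) T'_def by (rule sum.mono_neutral_right) (use T in auto)
  have "\<forall>b\<in>B. \<exists>\<nu>. \<forall>h. bracket (c h) b = scale (\<nu> h) b"
    using assms(4) by blast
  then obtain \<nu> where \<nu>: "\<And>b h. b \<in> B \<Longrightarrow> bracket (c h) b = scale (\<nu> b h) b"
    by metis
  have "(\<Sum>b\<in>T'. scale (r b) b) = 0"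
  proof (rule weight_sum_eq_0)
    show "finite T'"
      using T by (simp add: T'_def)
    show "bracket (c h) (scale (r b) b) = scale (\<nu> b h) (scale (r b) b)" if "b \<in> T'" for b h
      using that T \<nu> by (auto simp: T'_def bracket_scale_right mult.commute)
    show "\<nu> b \<noteq> \<mu>" if "b \<in> T'" for b
      using that T \<nu> none by (force simp: T'_def)
    show "bracket (c h) (\<Sum>b\<in>T'. scale (r b) b) = scale (\<mu> h) (\<Sum>b\<in>T'. scale (r b) b)" for h
      using assms(3) unfolding x .
  qed
  with x assms(2) show False by simp
qed

text \<open>Makes it enough to test stability of a subspace on generators of the algebra.\<close>

lemma lie_subalgebra_normalizer:
  assumes "subspace V"
  shows "lie_subalgebra {x. \<forall>y\<in>V. bracket x y \<in> V}"
proof -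
  have "bracket (bracket x x') y = bracket x (bracket x' y) - bracket x' (bracket x y)" for x x' y
    by (simp add: bracket_leibniz[of x x' y])
  then have "bracket (bracket x x') y \<in> V"
    if "\<forall>y\<in>V. bracket x y \<in> V" "\<forall>y\<in>V. bracket x' y \<in> V" "y \<in> V" for x x' y
    using that subspace_diff[OF assms] by metis
  moreover have "subspace {x. \<forall>y\<in>V. bracket x y \<in> V}"
    by (rule subspaceI)
      (simp_all add: bracket_add_left bracket_scale_left
        subspace_0[OF assms] subspace_add[OF assms] subspace_scale[OF assms])
  ultimately show ?thesis
    unfolding lie_subalgebra_def by blast
qed

end

section \<open>Integer combinations of simple roots\<close>

context kac_moody_algebra
begin

abbreviation root_comb :: "('n \<Rightarrow> int) \<Rightarrow> 'h \<Rightarrow> complex" where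
  "root_comb z \<equiv> \<lambda>h. \<Sum>k\<in>UNIV. of_int (z k) * simple_root K k h"

lemma root_comb_of_bool: "root_comb (\<lambda>k. of_bool (k = i)) = simple_root K i"
  by (simp add: of_bool_def if_distrib[of of_int] if_distrib[of "\<lambda>x. x * _"] cong: if_cong)

lemma root_comb_eqD:
  assumes "root_comb z = root_comb z'"
  shows "z = z'"
proof
  fix i
  have "(\<Sum>k\<in>UNIV. (of_int (z k) - of_int (z' k)) * simple_root K k h) = 0" for h
    using fun_cong[OF assms, of h] by (simp add: left_diff_distrib sum_subtractf)
  from simple_root_indep[of "\<lambda>k. of_int (z k) - of_int (z' k)", OF this] show "z i = z' i"
    by simp
qed

lemma simple_root_add: "simple_root K i (h + h') = simple_root K i h + simple_root K i h'"
  by (rule module_hom.add[OF Vector_Spaces.linear.axioms(3)[OF simple_root_linear]])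

lemma simple_root_scale: "simple_root K i (h_scale K a h) = a * simple_root K i h"
  by (rule module_hom.scale[OF Vector_Spaces.linear.axioms(3)[OF simple_root_linear]])

lemma simple_root_diff: "simple_root K i (h - h') = simple_root K i h - simple_root K i h'"
  by (rule module_hom.diff[OF Vector_Spaces.linear.axioms(3)[OF simple_root_linear]])

lemma simple_root_zero: "simple_root K i 0 = 0"
  by (rule module_hom.zero[OF Vector_Spaces.linear.axioms(3)[OF simple_root_linear]])

lemma simple_root_sum: "simple_root K i (\<Sum>k\<in>I. x k) = (\<Sum>k\<in>I. simple_root K i (x k))"
  by (rule module_hom.sum[OF Vector_Spaces.linear.axioms(3)[OF simple_root_linear]])

lemma cartan_zero: "cartan K 0 = 0"
  by (rule module_hom.zero[OF Vector_Spaces.linear.axioms(3)[OF cartan_linear]])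

lemma cartan_minus: "cartan K (- h) = - cartan K h"
  by (rule module_hom.neg[OF Vector_Spaces.linear.axioms(3)[OF cartan_linear]])

lemma root_comb_linear: "Vector_Spaces.linear (h_scale K) (*) (root_comb z)"
  using simple_root_linear unfolding Vector_Spaces.linear_iff
  by (simp add: distrib_left sum.distrib sum_distrib_left mult.left_commute)

lemma sum_list_simple_roots:
  "(\<Sum>i\<leftarrow>ws. simple_root K i h) = root_comb (\<lambda>k. int (count_list ws k)) h"
proof (induction ws)
  case (Cons i ws)
  have "root_comb (\<lambda>k. int (count_list (i # ws) k)) h =
      root_comb (\<lambda>k. of_bool (k = i)) h + root_comb (\<lambda>k. int (count_list ws k)) h"
    unfolding sum.distrib[symmetric] by (rule sum.cong) (auto simp: distrib_right)
  also have "\<dots> = simple_root K i h + (\<Sum>i\<leftarrow>ws. simple_root K i h)"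
    by (simp only: Cons.IH fun_cong[OF root_comb_of_bool])
  finally show ?case by simp
qed simp

section \<open>Spanning by words, and the shape of roots\<close>

lemma weight_e_word:
  "bracket K (cartan K h) (G.lie_word (gen_e K) ws j) =
    g_scale K (root_comb (\<lambda>k. int (count_list (ws @ [j]) k)) h) (G.lie_word (gen_e K) ws j)"
  unfolding G.weight_lie_word[of _ _ "\<lambda>i. simple_root K i h", OF bracket_h_e] sum_list_simple_roots ..

lemma weight_f_word:
  "bracket K (cartan K h) (G.lie_word (gen_f K) ws j) =
    g_scale K (root_comb (\<lambda>k. - int (count_list (ws @ [j]) k)) h) (G.lie_word (gen_f K) ws j)"
proof -
  have "(\<Sum>i\<leftarrow>ws @ [j]. - simple_root K i h) = - (\<Sum>i\<leftarrow>ws @ [j]. simple_root K i h)"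
    by (simp add: uminus_sum_list_map o_def)
  also have "\<dots> = root_comb (\<lambda>k. - int (count_list (ws @ [j]) k)) h"
    unfolding sum_list_simple_roots by (simp only: of_int_minus mult_minus_left sum_negf)
  finally show ?thesis
    by (simp only: G.weight_lie_word[of _ _ "\<lambda>i. - simple_root K i h", OF bracket_h_f])
qed

text \<open>The generators bracket the span into itself: Cartan elements act on each spanning vector
  by a scalar, a generator lengthens words of its own kind, and it is handled by
  \<open>bracket_opposite_lie_word\<close> on words of the other kind. The normalizer of the span is
  then the whole algebra, so the span is a subalgebra containing the generators.\<close>

lemma span_cartan_words:
  "G.span (range (cartan K) \<union> G.lie_words (gen_e K) \<union> G.lie_words (gen_f K)) = UNIV"
proof -
  let ?E = "G.lie_words (gen_e K)" and ?F = "G.lie_words (gen_f K)" and ?C = "range (cartan K)"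
  let ?S = "?C \<union> ?E \<union> ?F"
  let ?N = "{x. \<forall>y\<in>G.span ?S. bracket K x y \<in> G.span ?S}"
  have E: "G.span (?C \<union> ?E) \<subseteq> G.span ?S" and F: "G.span (?C \<union> ?F) \<subseteq> G.span ?S"
    by (rule G.span_mono, blast)+
  have ef: "bracket K (gen_e K i) (gen_f K j) \<in> ?C" for i j
    using rangeI[of "cartan K" 0] by (simp add: bracket_e_f cartan_zero)
  have fe: "bracket K (gen_f K i) (gen_e K j) \<in> ?C" for i j
  proof -
    obtain h where "bracket K (gen_e K j) (gen_f K i) = cartan K h"
      using ef by blast
    then have "bracket K (gen_f K i) (gen_e K j) = cartan K (- h)"
      by (subst G.bracket_anticomm) (simp add: cartan_minus)
    then show ?thesis by (simp only: rangeI)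
  qed
  have "bracket K x y \<in> G.span ?S"
    if x: "x \<in> ?C \<union> range (gen_e K) \<union> range (gen_f K)" and y: "y \<in> G.span ?S" for x y
  proof (rule G.bracket_in_span[OF y])
    fix b assume b: "b \<in> ?S"
    consider (c) h where "x = cartan K h" | (e) i where "x = gen_e K i" | (f) i where "x = gen_f K i"
      using x by blast
    then show "bracket K x b \<in> G.span ?S"
    proof cases
      case c
      consider (h) h' where "b = cartan K h'" | (ee) ws j where "b = G.lie_word (gen_e K) ws j"
        | (ff) ws j where "b = G.lie_word (gen_f K) ws j"
        using b by blast
      then have "\<exists>a. bracket K x b = g_scale K a b"
      proof cases
        case h
        then show ?thesis
          using cartan_abelian by (intro exI[of _ 0]) (simp add: c)
      next
        case ee
        show ?thesis
          unfolding c ee by (intro exI) (rule weight_e_word)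
      next
        case ff
        show ?thesis
          unfolding c ff by (intro exI) (rule weight_f_word)
      qed
      then obtain a where "bracket K x b = g_scale K a b" ..
      then show ?thesis
        using b by (simp only: G.span_scale G.span_base)
    next
      case e
      show ?thesis
      proof (cases "b \<in> ?F")
        case True
        then obtain ws j where b: "b = G.lie_word (gen_f K) ws j" by blast
        have "bracket K x b \<in> G.span (?C \<union> ?F)"
          unfolding e b
          by (rule G.bracket_opposite_lie_word[of _ _ "\<lambda>i h. - simple_root K i h", OF bracket_h_f ef])
        then show ?thesis
          by (rule subsetD[OF F])
      next
        case False
        then have "b \<in> G.span (?C \<union> ?E)"
          using b by (intro G.span_base) blast
        from subsetD[OF E G.bracket_generator_stable[OF bracket_h_e this]] show ?thesis
          by (simp only: e)
      qed
    next
      case f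
      show ?thesis
      proof (cases "b \<in> ?E")
        case True
        then obtain ws j where b: "b = G.lie_word (gen_e K) ws j" by blast
        have "bracket K x b \<in> G.span (?C \<union> ?E)"
          unfolding f b by (rule G.bracket_opposite_lie_word[OF bracket_h_e fe])
        then show ?thesis
          by (rule subsetD[OF E])
      next
        case False
        then have "b \<in> G.span (?C \<union> ?F)"
          using b by (intro G.span_base) blast
        from subsetD[OF F G.bracket_generator_stable[of _ _ "\<lambda>i h. - simple_root K i h", OF bracket_h_f this]]
        show ?thesis
          by (simp only: f)
      qed
    qed
  qed
  then have "?C \<union> range (gen_e K) \<union> range (gen_f K) \<subseteq> ?N"
    by (intro subsetI CollectI ballI)
  then have "?N = UNIV"
    by (rule generated[OF G.lie_subalgebra_normalizer[OF G.subspace_span]])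
  then have "bracket K x y \<in> G.span ?S" if "y \<in> G.span ?S" for x y
    using that by blast
  then have "G.lie_subalgebra (G.span ?S)"
    unfolding G.lie_subalgebra_def by (intro conjI G.subspace_span ballI)
  moreover have "?C \<union> range (gen_e K) \<union> range (gen_f K) \<subseteq> ?S"
    by (intro Un_mono order_refl image_subsetI G.generator_in_lie_words)
  then have "?C \<union> range (gen_e K) \<union> range (gen_f K) \<subseteq> G.span ?S"
    using G.span_superset by (rule order_trans)
  ultimately show ?thesis
    by (rule generated)
qed

lemma weight_unique:
  assumes "x \<noteq> 0" and "\<And>h. bracket K (cartan K h) x = g_scale K (\<mu> h) x"
    and "\<And>h. bracket K (cartan K h) x = g_scale K (\<nu> h) x"
  shows "\<mu> = \<nu>"
  using assms by (metis ext G.scale_right_imp_eq)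

text \<open>Some nonzero spanning vector has the weight of the given root, and the weight of a word
  is its letter count, with a sign for words in the f_i.\<close>

lemma root_comb_is_rootE:
  assumes "is_root K (root_comb z)"
  obtains ws j where "G.lie_word (gen_e K) ws j \<noteq> 0" "\<And>k. z k = int (count_list (ws @ [j]) k)"
  | ws j where "G.lie_word (gen_f K) ws j \<noteq> 0" "\<And>k. z k = - int (count_list (ws @ [j]) k)"
proof -
  let ?B = "range (cartan K) \<union> G.lie_words (gen_e K) \<union> G.lie_words (gen_f K)"
  obtain x where x: "x \<noteq> 0" "\<And>h. bracket K (cartan K h) x = g_scale K (root_comb z h) x"
    using assms unfolding is_root_def by blast
  have B: "\<exists>\<nu>. \<forall>h. bracket K (cartan K h) b = g_scale K (\<nu> h) b" if b: "b \<in> ?B" for b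
  proof -
    consider h where "b = cartan K h" | ws j where "b = G.lie_word (gen_e K) ws j"
      | ws j where "b = G.lie_word (gen_f K) ws j"
      using b by blast
    then show ?thesis
    proof cases
      case 1
      then show ?thesis
        by (intro exI[of _ "\<lambda>_. 0"]) (simp add: cartan_abelian)
    next
      case 2
      show ?thesis
        unfolding 2 by (intro exI allI) (rule weight_e_word)
    next
      case 3
      show ?thesis
        unfolding 3 by (intro exI allI) (rule weight_f_word)
    qed
  qed
  have "x \<in> G.span ?B"
    by (simp only: span_cartan_words UNIV_I)
  from G.weight_of_spanning_set[OF this x B]
  obtain b where b: "b \<in> ?B" "b \<noteq> 0"
    "\<And>h. bracket K (cartan K h) b = g_scale K (root_comb z h) b"
    by blast
  have unique: "z = z'" if "\<And>h. bracket K (cartan K h) b = g_scale K (root_comb z' h) b" for z'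
    by (rule root_comb_eqD, rule weight_unique[OF b(2) b(3) that])
  consider h where "b = cartan K h" | ws j where "b = G.lie_word (gen_e K) ws j"
    | ws j where "b = G.lie_word (gen_f K) ws j"
    using b by blast
  then show thesis
  proof cases
    case 1
    \<comment> \<open>Cartan elements have weight zero, which \<open>is_root\<close>
      excludes.\<close>
    then have "z = (\<lambda>_. 0)"
      by (intro unique) (simp add: cartan_abelian)
    then show thesis
      using assms by (simp add: is_root_def)
  next
    case (2 ws j)
    then show thesis
      using that(1)[of ws j] b(2) unique[OF weight_e_word[of _ ws j, folded 2]] by simp
  next
    case (3 ws j)
    then show thesis
      using that(2)[of ws j] b(2) unique[OF weight_f_word[of _ ws j, folded 3]] by simp
  qed
qed

lemma root_not_mixed:
  assumes "is_root K (root_comb z)" and "z i > 0"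
  shows "z j \<ge> 0"
proof (rule root_comb_is_rootE[OF assms(1)])
  fix ws l
  assume "\<And>k. z k = int (count_list (ws @ [l]) k)"
  then show ?thesis by (metis of_nat_0_le_iff)
next
  fix ws l
  assume "\<And>k. z k = - int (count_list (ws @ [l]) k)"
  then have "z i \<le> 0" by (metis neg_le_0_iff_le of_nat_0_le_iff)
  with assms(2) show ?thesis by simp
qed

text \<open>The word carrying such a root uses the letter \<open>p\<close> only, so by
  \<open>lie_word_repeated\<close> it has length one. Absolute values treat words in the e_i and in
  the f_i together.\<close>

lemma root_multiple:
  assumes "is_root K (root_comb z)" and "\<And>k. k \<noteq> p \<Longrightarrow> z k = 0"
  shows "\<bar>z p\<bar> = 1"
proof -
  have "count_list (ws @ [j]) p = 1"
    if nonzero: "G.lie_word e ws j \<noteq> 0"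
      and z: "\<And>k. \<bar>z k\<bar> = int (count_list (ws @ [j]) k)" for e ws j
  proof -
    have "k = p" if "k \<in> set (ws @ [j])" for k
    proof (rule ccontr)
      assume "k \<noteq> p"
      then have "count_list (ws @ [j]) k = 0"
        using assms(2)[of k] z[of k] by simp
      then show False
        using that by (simp only: count_list_0_iff) simp
    qed
    then have "j = p" "set ws \<subseteq> {j}"
      by auto
    then show ?thesis
      using G.lie_word_repeated[of ws j e] nonzero by (cases "ws = []") auto
  qed
  note one = this
  show ?thesis
  proof (rule root_comb_is_rootE[OF assms(1)])
    fix ws j
    assume "G.lie_word (gen_e K) ws j \<noteq> 0" and z: "\<And>k. z k = int (count_list (ws @ [j]) k)"
    then have "count_list (ws @ [j]) p = 1"
      by (intro one[of _ ws j]) (simp_all only: z abs_minus_cancel abs_of_nat)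
    then show ?thesis
      unfolding z by (simp only: abs_minus_cancel abs_of_nat of_nat_1)
  next
    fix ws j
    assume "G.lie_word (gen_f K) ws j \<noteq> 0" and z: "\<And>k. z k = - int (count_list (ws @ [j]) k)"
    then have "count_list (ws @ [j]) p = 1"
      by (intro one[of _ ws j]) (simp_all only: z abs_minus_cancel abs_of_nat)
    then show ?thesis
      unfolding z by (simp only: abs_minus_cancel abs_of_nat of_nat_1)
  qed
qed

section \<open>Roots from nonzero words: the alpha_p-string through alpha_q\<close>

lemma e_word_is_root:
  assumes "G.lie_word (gen_e K) ws j \<noteq> 0"
  shows "is_root K (root_comb (\<lambda>k. int (count_list (ws @ [j]) k)))"
proof -
  let ?z = "\<lambda>k. int (count_list (ws @ [j]) k)"
  have "\<exists>h. root_comb ?z h \<noteq> 0"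
  proof (rule ccontr)
    assume "\<not> ?thesis"
    \<comment> \<open>The coefficient at \<open>j\<close> is at least one because \<open>j\<close>
      is the last letter.\<close>
    then have "?z = (\<lambda>_. 0)"
      by (intro root_comb_eqD) auto
    from fun_cong[OF this, of j] show False by simp
  qed
  moreover have "\<exists>x. x \<noteq> 0 \<and> (\<forall>h. bracket K (cartan K h) x = g_scale K (root_comb ?z h) x)"
    by (rule exI[of _ "G.lie_word (gen_e K) ws j"], intro conjI allI assms weight_e_word)
  ultimately show ?thesis
    unfolding is_root_def by (intro conjI root_comb_linear)
qed

text \<open>Otherwise [e_i, f_i] = 0 would force the simple coroot to vanish, although alpha_i takes
  the value 2 on it.\<close>

lemma gen_e_nonzero: "gen_e K i \<noteq> 0"
proof
  assume "gen_e K i = 0"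
  then have "cartan K (simple_coroot K i) = cartan K 0"
    using bracket_e_f[of i i] by (simp add: cartan_zero)
  then have "simple_coroot K i = 0"
    by (rule injD[OF cartan_inj])
  then show False
    using cartan_matrix[of i i] gcm by (simp add: simple_root_zero gcm_def)
qed

text \<open>The sl_2 formula for the vector e_q, which ad f_p kills and on which the coroot of
  alpha_p acts by a_pq. Each passage of f_p over an e_p contributes -(2t + a_pq), and the sum over t
  = 0, ..., m is (m + 1)(-a_pq - m).\<close>

lemma bracket_f_string:
  assumes "p \<noteq> q"
  shows "bracket K (gen_f K p) (G.lie_word (gen_e K) (replicate (Suc m) p) q) =
    g_scale K (of_int (int (Suc m) * (- (A $ p $ q) - int m))) (G.lie_word (gen_e K) (replicate m p) q)"
proof -
  let ?w = "\<lambda>m. G.lie_word (gen_e K) (replicate m p) q"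
  have "bracket K (gen_f K p) (gen_e K p) = cartan K (- simple_coroot K p)"
    by (subst G.bracket_anticomm) (simp add: bracket_e_f cartan_minus)
  moreover have "(\<Sum>i\<leftarrow>replicate m p @ [q]. simple_root K i (- simple_coroot K p)) =
      of_int (- (2 * int m + A $ p $ q))" for m
    using simple_root_diff[of _ 0 "simple_coroot K p"] gcm
    by (simp add: simple_root_zero cartan_matrix gcm_def sum_list_replicate)
  ultimately have step: "bracket K (gen_f K p) (?w (Suc m)) =
      g_scale K (of_int (- (2 * int m + A $ p $ q))) (?w m) +
      bracket K (gen_e K p) (bracket K (gen_f K p) (?w m))" for m
    using G.weight_lie_word[of _ _ "\<lambda>i. simple_root K i (- simple_coroot K p)", OF bracket_h_e]
    by (simp only: replicate_Suc foldr.simps o_apply G.bracket_leibniz[of "gen_f K p" "gen_e K p"])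
  show ?thesis
  proof (induction m)
    case 0
    have "bracket K (gen_f K p) (gen_e K q) = 0"
      using bracket_e_f[of q p] assms by (subst G.bracket_anticomm) simp
    then show ?case
      unfolding step by simp
  next
    case (Suc m)
    have "bracket K (gen_f K p) (?w (Suc (Suc m))) =
        g_scale K (of_int (- (2 * int (Suc m) + A $ p $ q)) +
          of_int (int (Suc m) * (- (A $ p $ q) - int m))) (?w (Suc m))"
      unfolding step[of "Suc m"] Suc.IH by (simp add: G.bracket_scale_right G.scale_left_distrib)
    also have "of_int (- (2 * int (Suc m) + A $ p $ q)) + of_int (int (Suc m) * (- (A $ p $ q) - int m)) =
        (of_int (int (Suc (Suc m)) * (- (A $ p $ q) - int (Suc m))) :: complex)"
      unfolding of_int_add[symmetric] of_int_eq_iff by (simp add: algebra_simps)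
    finally show ?case .
  qed
qed

text \<open>The factor in \<open>bracket_f_string\<close> is nonzero as long as m < -a_pq, so a
  vanishing word would make the next shorter one vanish, down to e_q.\<close>

lemma root_string_nonzero:
  assumes "p \<noteq> q" and "int m \<le> - (A $ p $ q)"
  shows "G.lie_word (gen_e K) (replicate m p) q \<noteq> 0"
  using assms(2)
proof (induction m)
  case 0
  then show ?case
    using gen_e_nonzero by simp
next
  case (Suc m)
  show ?case
  proof
    assume "G.lie_word (gen_e K) (replicate (Suc m) p) q = 0"
    then have "of_int (int (Suc m) * (- (A $ p $ q) - int m)) = (0 :: complex)"
      using bracket_f_string[OF assms(1), of m] Suc by (simp del: of_int_mult)
    then show False
      using Suc.prems by (simp only: of_int_eq_0_iff) simp
  qed
qed

lemma simple_root_string_is_root: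
  assumes "p \<noteq> q" and "0 \<le> m" and "m \<le> - (A $ p $ q)"
  shows "is_root K (\<lambda>h. simple_root K q h + of_int m * simple_root K p h)"
proof -
  have "is_root K (root_comb (\<lambda>k. int (count_list (replicate (nat m) p @ [q]) k)))"
    by (intro e_word_is_root root_string_nonzero) (use assms in auto)
  moreover have "root_comb (\<lambda>k. int (count_list (replicate (nat m) p @ [q]) k)) h =
      simple_root K q h + of_int m * simple_root K p h" for h
    unfolding sum_list_simple_roots[symmetric] using assms(2)
    by (simp add: sum_list_replicate add.commute)
  ultimately show ?thesis
    by (simp only:)
qed

lemma simple_root_is_root: "is_root K (simple_root K i)"
proof -
  have "G.lie_word (gen_e K) [] i \<noteq> 0"
    using gen_e_nonzero by simp
  from e_word_is_root[OF this] show ?thesis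
    unfolding sum_list_simple_roots[symmetric] by simp
qed

section \<open>The Weyl group and coroots\<close>

text \<open>The form (alpha_i, alpha_j) = d_i a_ij matches alpha_k with d_k times its coroot, and
  this matching commutes with simple reflections. Hence one integer vector \<open>r\<close>
  describes both the root and its coroot, the latter rescaled by 1 / d_i.\<close>

lemma weyl_simple_root_expansion:
  assumes d: "\<And>i. d i \<noteq> 0"
    and sym: "\<And>i j. d i * of_int (A $ i $ j) = d j * of_int (A $ j $ i)"
  shows "\<exists>r. weyl K w (simple_root K i) = root_comb r \<and>
    coweyl K w (simple_coroot K i) =
      (\<Sum>k\<in>UNIV. h_scale K (d k / d i * of_int (r k)) (simple_coroot K k))"
proof (induction w)
  case Nil
  have "simple_coroot K i =
      (\<Sum>k\<in>UNIV. h_scale K (d k / d i * of_int (of_bool (k = i))) (simple_coroot K k))"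
  proof -
    have "h_scale K (d k / d i * of_int (of_bool (k = i))) (simple_coroot K k) =
        (if k = i then simple_coroot K i else 0)" for k
      using d[of i] by simp
    then show ?thesis by simp
  qed
  then show ?case
    unfolding weyl_def coweyl_def foldr.simps id_apply
    by (intro exI[of _ "\<lambda>k. of_bool (k = i)"] conjI root_comb_of_bool[symmetric])
next
  case (Cons l w)
  then obtain r where r: "weyl K w (simple_root K i) = root_comb r"
    "coweyl K w (simple_coroot K i) =
      (\<Sum>k\<in>UNIV. h_scale K (d k / d i * of_int (r k)) (simple_coroot K k))"
    by blast
  \<comment> \<open>The value of the current root on the coroot of alpha_l; reflecting changes only
    the l-th coefficient, by -s.\<close>
  define s where "s = (\<Sum>k\<in>UNIV. r k * A $ l $ k)"
  define r' where "r' k = r k - s * of_bool (k = l)" for k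
  have "weyl K (l # w) (simple_root K i) = root_comb r'"
  proof
    fix h
    have "root_comb r (simple_coroot K l) = of_int s"
      by (simp add: s_def cartan_matrix)
    moreover have "root_comb r' h = root_comb r h - of_int s * root_comb (\<lambda>k. of_bool (k = l)) h"
      unfolding r'_def sum_distrib_left sum_subtractf[symmetric]
      by (rule sum.cong) (simp_all add: left_diff_distrib)
    ultimately have "root_comb r' h = reflection K l (root_comb r) h"
      unfolding reflection_def by (simp only: fun_cong[OF root_comb_of_bool])
    then show "weyl K (l # w) (simple_root K i) h = root_comb r' h"
      using r(1) by (simp only: weyl_def foldr.simps o_apply)
  qed
  moreover have "coweyl K (l # w) (simple_coroot K i) =
      (\<Sum>k\<in>UNIV. h_scale K (d k / d i * of_int (r' k)) (simple_coroot K k))"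
  proof -
    have "simple_root K l (coweyl K w (simple_coroot K i)) =
        (\<Sum>k\<in>UNIV. d k / d i * of_int (r k) * of_int (A $ k $ l))"
      unfolding r(2) by (simp add: simple_root_sum simple_root_scale cartan_matrix)
    \<comment> \<open>Symmetry of d_k a_kl moves the index k out of the factor d, so the dual
      pairing is the same s up to d_l / d_i.\<close>
    also have "\<dots> = (\<Sum>k\<in>UNIV. d l / d i * (of_int (r k) * of_int (A $ l $ k)))"
    proof (rule sum.cong)
      fix k
      have "d k / d i * of_int (r k) * of_int (A $ k $ l) =
          of_int (r k) / d i * (d k * of_int (A $ k $ l))"
        by simp
      also have "\<dots> = d l / d i * (of_int (r k) * of_int (A $ l $ k))"
        by (simp add: sym[of k l])
      finally show "d k / d i * of_int (r k) * of_int (A $ k $ l) =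
          d l / d i * (of_int (r k) * of_int (A $ l $ k))" .
    qed simp
    also have "\<dots> = d l / d i * of_int s"
      by (simp add: s_def sum_distrib_left)
    finally have pair: "simple_root K l (coweyl K w (simple_coroot K i)) = d l / d i * of_int s" .
    have "h_scale K (d k / d i * of_int (r' k)) (simple_coroot K k) =
        h_scale K (d k / d i * of_int (r k)) (simple_coroot K k) -
        (if k = l then h_scale K (d l / d i * of_int s) (simple_coroot K l) else 0)" for k
      by (simp add: r'_def right_diff_distrib H.scale_left_diff_distrib)
    then have "(\<Sum>k\<in>UNIV. h_scale K (d k / d i * of_int (r' k)) (simple_coroot K k)) =
        coweyl K w (simple_coroot K i) - h_scale K (d l / d i * of_int s) (simple_coroot K l)"
      by (simp add: sum_subtractf r(2))
    with pair show ?thesis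
      by (simp add: coweyl_def coreflection_def)
  qed
  ultimately show ?case by blast
qed

text \<open>The two terms -\<mu>(alpha_i^vee) alpha_i(h) cancel against the last product, which
  carries alpha_i(alpha_i^vee) = 2.\<close>

lemma reflection_pairing:
  assumes "Vector_Spaces.linear (h_scale K) (*) \<mu>"
  shows "reflection K i \<mu> (coreflection K i h) = \<mu> h"
proof -
  interpret \<mu>: Vector_Spaces.linear "h_scale K" "(*)" \<mu> by fact
  show ?thesis
    using gcm by (simp add: reflection_def coreflection_def \<mu>.diff \<mu>.scale simple_root_diff
        simple_root_scale cartan_matrix gcm_def algebra_simps)
qed

lemma reflection_linear:
  assumes "Vector_Spaces.linear (h_scale K) (*) \<mu>"
  shows "Vector_Spaces.linear (h_scale K) (*) (reflection K i \<mu>)"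
  using assms unfolding Vector_Spaces.linear_iff reflection_def
  by (simp add: simple_root_add simple_root_scale algebra_simps)

lemma weyl_linear:
  assumes "Vector_Spaces.linear (h_scale K) (*) \<mu>"
  shows "Vector_Spaces.linear (h_scale K) (*) (weyl K w \<mu>)"
  by (induction w) (simp_all add: weyl_def assms reflection_linear)

lemma weyl_pairing:
  assumes "Vector_Spaces.linear (h_scale K) (*) \<mu>"
  shows "weyl K w \<mu> (coweyl K w h) = \<mu> h"
proof (induction w)
  case (Cons i w)
  then show ?case
    using reflection_pairing[OF weyl_linear[OF assms, of w], of i] by (simp add: weyl_def coweyl_def)
qed (simp add: weyl_def coweyl_def)

text \<open>
  A symmetrization of \<open>A\<close> makes the coroot of a real root proportional to a vector that depends
  on the root alone; the pairing \<open>\<langle>\<beta>, \<beta>\<^sup>\<or>\<rangle> = 2\<close> then fixes the scalar.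
\<close>

lemma coroot_unique:
  assumes "symmetrizable A"
    and eq: "weyl K w (simple_root K i) = weyl K w' (simple_root K j)"
  shows "coweyl K w (simple_coroot K i) = coweyl K w' (simple_coroot K j)"
proof -
  obtain d' :: "'n \<Rightarrow> real" where d': "\<And>i. d' i \<noteq> 0"
    "\<And>i j. d' i * of_int (A $ i $ j) = d' j * of_int (A $ j $ i)"
    using assms(1) unfolding symmetrizable_def by blast
  define d where "d i = complex_of_real (d' i)" for i
  have d: "d i \<noteq> 0" for i
    by (simp add: d_def d'(1))
  have sym: "d i * of_int (A $ i $ j) = d j * of_int (A $ j $ i)" for i j
    using arg_cong[OF d'(2)[of i j], of complex_of_real] by (simp add: d_def)
  note expansion = weyl_simple_root_expansion[of d, OF d sym]
  obtain r where r: "weyl K w (simple_root K i) = root_comb r"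
    "coweyl K w (simple_coroot K i) =
      (\<Sum>k\<in>UNIV. h_scale K (d k / d i * of_int (r k)) (simple_coroot K k))"
    using expansion[of w i] by blast
  obtain r' where r': "weyl K w' (simple_root K j) = root_comb r'"
    "coweyl K w' (simple_coroot K j) =
      (\<Sum>k\<in>UNIV. h_scale K (d k / d j * of_int (r' k)) (simple_coroot K k))"
    using expansion[of w' j] by blast
  have "r' = r"
    by (rule root_comb_eqD) (simp only: r(1)[symmetric] r'(1)[symmetric] eq)
  define y where "y = (\<Sum>k\<in>UNIV. h_scale K (d k * of_int (r k)) (simple_coroot K k))"
  have y: "coweyl K w (simple_coroot K i) = h_scale K (1 / d i) y"
    "coweyl K w' (simple_coroot K j) = h_scale K (1 / d j) y"
    unfolding r(2) r'(2) \<open>r' = r\<close> y_def by (simp_all add: H.scale_sum_right)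
  have two: "weyl K w (simple_root K i) (coweyl K w (simple_coroot K i)) = 2"
    "weyl K w (simple_root K i) (coweyl K w' (simple_coroot K j)) = 2"
    unfolding eq weyl_pairing[OF simple_root_linear]
    using weyl_pairing[OF simple_root_linear, of w i "simple_coroot K i"] gcm
    by (simp_all add: cartan_matrix gcm_def eq)
  interpret \<mu>: Vector_Spaces.linear "h_scale K" "(*)" "weyl K w (simple_root K i)"
    by (rule weyl_linear[OF simple_root_linear])
  have "1 / d i * weyl K w (simple_root K i) y = 1 / d j * weyl K w (simple_root K i) y"
    and "1 / d i * weyl K w (simple_root K i) y \<noteq> 0"
    using two unfolding y \<mu>.scale by simp_all
  then have "1 / d i = 1 / d j" by simp
  then show ?thesis
    unfolding y by simp
qed

text \<open>Allows a coroot to be computed from any presentation of the root, since by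
  \<open>coroot_unique\<close> all of them agree.\<close>

lemma coroot_weyl:
  assumes "symmetrizable A"
  shows "coroot K (weyl K w (simple_root K i)) = coweyl K w (simple_coroot K i)"
  unfolding coroot_def
proof (rule the_equality)
  fix b
  assume "\<exists>w' j. weyl K w (simple_root K i) = weyl K w' (simple_root K j) \<and>
    b = coweyl K w' (simple_coroot K j)"
  then obtain w' j where eq: "weyl K w (simple_root K i) = weyl K w' (simple_root K j)"
    and b: "b = coweyl K w' (simple_coroot K j)"
    by blast
  show "b = coweyl K w (simple_coroot K i)"
    unfolding b by (rule coroot_unique[OF assms eq, symmetric])
qed blast

lemma coroot_simple_root:
  assumes "symmetrizable A"
  shows "coroot K (simple_root K i) = simple_coroot K i"
  using coroot_weyl[OF assms, of "[]" i] by (simp add: weyl_def coweyl_def)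

lemma coroot_reflection:
  assumes "symmetrizable A"
  shows "coroot K (reflection K p (simple_root K q)) = coreflection K p (simple_coroot K q)"
  using coroot_weyl[OF assms, of "[p]" q] by (simp add: weyl_def coweyl_def)

lemma real_rootI:
  assumes "is_root K (weyl K w (simple_root K i))"
  shows "real_root K (weyl K w (simple_root K i))"
  using assms unfolding real_root_def by blast

end

section \<open>The \<pi>-system and its type\<close>

theorem mainTheorem6:
  fixes A :: "int^'n^'n"
    and K :: "('n::finite, 'h::ab_group_add, 'g::ab_group_add) km_data"
    and p q :: 'n and c :: int
    and \<beta> :: "'n \<Rightarrow> 'h \<Rightarrow> complex"
  assumes "kac_moody_algebra A K"
    and "symmetrizable A"
    and "p \<noteq> q"
    and "A $ q $ p = -1"
    and "A $ p $ q = -c"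
    and "c = 2 \<or> c = 3 \<or> c = 4"
    and "\<beta> p = reflection K p (simple_root K q)"
    and "\<And>j. j \<noteq> p \<Longrightarrow> \<beta> j = simple_root K j"
  shows "\<beta> p = (\<lambda>h. simple_root K q h + of_int c * simple_root K p h) \<and>
    pi_system K \<beta> \<and>
    (\<exists>B :: int^'n^'n. has_type K \<beta> B \<and>
      (\<forall>j. j \<noteq> p \<longrightarrow> B $ j $ p = A $ j $ q + c * A $ j $ p) \<and>
      (\<forall>j. j \<noteq> p \<longrightarrow> B $ p $ j = A $ q $ j + A $ p $ j) \<and>
      (\<forall>i j. i \<noteq> p \<longrightarrow> j \<noteq> p \<longrightarrow> B $ i $ j = A $ i $ j) \<and>
      (c = 2 \<longrightarrow> B $ p $ q = 0 \<and> B $ q $ p = 0) \<and>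
      (c = 3 \<longrightarrow> B $ p $ q = -1 \<and> B $ q $ p = -1) \<and>
      (c = 4 \<longrightarrow> B $ p $ q = -2 \<and> B $ q $ p = -2))"
proof -
  interpret kac_moody_algebra A K by fact
  have diag: "A $ i $ i = 2" for i
    using gcm by (simp add: gcm_def)
  have nonpos: "A $ i $ j \<le> 0" if "i \<noteq> j" for i j
    using gcm that by (simp add: gcm_def)
  have zero: "A $ j $ i = 0" if "A $ i $ j = 0" for i j
    using gcm that by (simp add: gcm_def)
  note p_q = assms(3) and a_qp = assms(4) and a_pq = assms(5) and c = assms(6)
    and \<beta>_p = assms(7) and \<beta>_simple = assms(8)
  have \<beta>_p_eq: "\<beta> p = (\<lambda>h. simple_root K q h + of_int c * simple_root K p h)"
    unfolding \<beta>_p reflection_def by (simp add: cartan_matrix a_pq)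
  define z where "z i = (if i = p then (\<lambda>k. of_bool (k = q) + c * of_bool (k = p))
    else (\<lambda>k. of_bool (k = i)))" for i
  have \<beta>_comb: "\<beta> i h = root_comb (z i) h" for i h
  proof (cases "i = p")
    case True
    have "root_comb (z p) h =
        root_comb (\<lambda>k. of_bool (k = q)) h + of_int c * root_comb (\<lambda>k. of_bool (k = p)) h"
      unfolding z_def sum_distrib_left sum.distrib[symmetric]
      by (rule sum.cong) (simp_all add: distrib_right)
    also have "\<dots> = \<beta> p h"
      by (simp only: \<beta>_p_eq fun_cong[OF root_comb_of_bool])
    finally show ?thesis
      using True by simp
  next
    case False
    have "root_comb (z i) h = simple_root K i h"
      using False by (simp only: z_def if_False fun_cong[OF root_comb_of_bool])
    then show ?thesis
      by (simp only: \<beta>_simple[OF False])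
  qed
  have diff: "(\<lambda>h. \<beta> i h - \<beta> j h) = root_comb (\<lambda>k. z i k - z j k)" for i j
    by (simp only: \<beta>_comb of_int_diff left_diff_distrib sum_subtractf)

  have "\<not> is_root K (\<lambda>h. \<beta> i h - \<beta> j h)" if "i \<noteq> j" for i j
  proof
    assume "is_root K (\<lambda>h. \<beta> i h - \<beta> j h)"
    then have root: "is_root K (root_comb (\<lambda>k. z i k - z j k))"
      by (simp only: diff)
    consider "i = p" "j = q" | "i = q" "j = p" | "\<not> (i = p \<and> j = q)" "\<not> (i = q \<and> j = p)"
      by blast
    then show False
    proof cases
      case 1
      have "\<bar>z i p - z j p\<bar> = 1"
        by (rule root_multiple[OF root]) (use 1 p_q in \<open>auto simp: z_def\<close>)
      then show False
        using 1 p_q c by (auto simp: z_def)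
    next
      case 2
      have "\<bar>z i p - z j p\<bar> = 1"
        by (rule root_multiple[OF root]) (use 2 p_q in \<open>auto simp: z_def\<close>)
      then show False
        using 2 p_q c by (auto simp: z_def)
    next
      case 3
      \<comment> \<open>The simple root at \<open>k\<close> occurs in \<beta>_i but not in
        \<beta>_j, the one at \<open>l\<close> the other way round; for \<beta>_p its
        alpha_q-coefficient 1 serves.\<close>
      define k where "k = (if i = p then q else i)"
      define l where "l = (if j = p then q else j)"
      have "z i k - z j k > 0" "z i l - z j l < 0"
        using 3 that p_q by (auto simp: z_def k_def l_def)
      with root_not_mixed[OF root, of k l] show False by simp
    qed
  qed
  moreover have "real_root K (\<beta> i)" for i
  proof (cases "i = p")
    case True
    \<comment> \<open>The top of the string, m = c = -a_pq.\<close>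
    have "is_root K (\<beta> p)"
      unfolding \<beta>_p_eq by (rule simple_root_string_is_root) (use p_q a_pq c in auto)
    then show ?thesis
      using real_rootI[of "[p]" q] True by (simp add: weyl_def \<beta>_p)
  next
    case False
    then show ?thesis
      using real_rootI[of "[]" i] simple_root_is_root[of i] by (simp add: weyl_def \<beta>_simple)
  qed
  moreover have "inj \<beta>"
  proof (rule injI, rule ccontr)
    fix i j assume "\<beta> i = \<beta> j" "i \<noteq> j"
    have "z i = z j"
      by (rule root_comb_eqD) (simp only: \<beta>_comb[symmetric] \<open>\<beta> i = \<beta> j\<close>)
    \<comment> \<open>The coefficient at \<open>p\<close> separates \<beta>_p from the simple roots,
      the one at \<open>i\<close> separates two simple roots.\<close>
    from fun_cong[OF this, of i] fun_cong[OF this, of p] show False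
      using \<open>i \<noteq> j\<close> p_q c by (auto simp: z_def split: if_splits)
  qed
  ultimately have pi: "pi_system K \<beta>"
    unfolding pi_system_def by blast

  \<comment> \<open>Row p pairs with the coroot alpha_q^vee + alpha_p^vee of \<beta>_p, column p
    with \<beta>_p = alpha_q + c alpha_p.\<close>
  define B :: "int^'n^'n" where "B = (\<chi> i j. if i = p then if j = p then 2 else A $ q $ j + A $ p $ j
    else if j = p then A $ i $ q + c * A $ i $ p else A $ i $ j)"
  have B: "B $ p $ p = 2"
    "\<And>j. j \<noteq> p \<Longrightarrow> B $ p $ j = A $ q $ j + A $ p $ j"
    "\<And>i. i \<noteq> p \<Longrightarrow> B $ i $ p = A $ i $ q + c * A $ i $ p"
    "\<And>i j. i \<noteq> p \<Longrightarrow> j \<noteq> p \<Longrightarrow> B $ i $ j = A $ i $ j"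
    by (simp_all add: B_def)
  have B_pq: "B $ p $ q = 2 - c" "B $ q $ p = 2 - c"
    using B(2)[of q] B(3)[of q] p_q by (simp_all add: diag a_pq a_qp)
  have mult_nonpos: "c * A $ i $ p \<le> 0" if "i \<noteq> p" for i
    using nonpos[OF that] c by (intro mult_nonneg_nonpos) auto
  have "gcm B"
    unfolding gcm_def
  proof (intro conjI allI impI)
    show "B $ i $ i = 2" for i
      by (cases "i = p") (simp_all add: B diag)
    show "B $ i $ j \<le> 0" if neq: "i \<noteq> j" for i j
    proof -
      consider "i = p" "j = q" | "i = q" "j = p" | "i = p" "j \<noteq> p" "j \<noteq> q"
        | "j = p" "i \<noteq> p" "i \<noteq> q" | "i \<noteq> p" "j \<noteq> p"
        using neq by blast
      then show ?thesis
      proof cases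
        case 1
        then show ?thesis using B_pq c by auto
      next
        case 2
        then show ?thesis using B_pq c by auto
      next
        case 3
        then show ?thesis using B(2)[of j] nonpos[of q j] nonpos[of p j] by simp
      next
        case 4
        then show ?thesis using B(3)[of i] nonpos[of i q] mult_nonpos[of i] by simp
      next
        case 5
        then show ?thesis using B(4) nonpos neq by simp
      qed
    qed
    show "B $ j $ i = 0" if "B $ i $ j = 0" for i j
    proof -
      consider "i = p" "j = p" | "i = p" "j = q" | "i = q" "j = p" | "i = p" "j \<noteq> p" "j \<noteq> q"
        | "j = p" "i \<noteq> p" "i \<noteq> q" | "i \<noteq> p" "j \<noteq> p"
        by blast
      then show ?thesis
      proof cases
        case 1
        then show ?thesis using that by simp
      next
        case 2
        then show ?thesis using B_pq that by simp
      next
        case 3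
        then show ?thesis using B_pq that by simp
      next
        case 4
        \<comment> \<open>A sum of two nonpositive numbers vanishes only if both do, so a zero of B
          comes from zeros of A, which are symmetric.\<close>
        then have "A $ q $ j = 0" "A $ p $ j = 0"
          using that B(2)[of j] nonpos[of q j] nonpos[of p j] by auto
        then show ?thesis
          using 4 B(3)[of j] zero by simp
      next
        case 5
        then have "A $ i $ q = 0" "c * A $ i $ p = 0"
          using that B(3)[of i] nonpos[of i q] mult_nonpos[of i] by (simp_all del: mult_eq_0_iff)
        then show ?thesis
          using 5 B(2)[of i] zero c by auto
      next
        case 6
        then show ?thesis using that B(4) zero by simp
      qed
    qed
  qed
  moreover have "of_int (B $ i $ j) = \<beta> j (coroot K (\<beta> i))" for i j
  proof -
    have pair: "\<beta> j (simple_coroot K l) =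
        of_int (if j = p then A $ l $ q + c * A $ l $ p else A $ l $ j)" for l
      by (cases "j = p") (simp_all add: \<beta>_p_eq \<beta>_simple cartan_matrix)
    show ?thesis
    proof (cases "i = p")
      case False
      then show ?thesis
        using coroot_simple_root[OF assms(2), of i] pair[of i] by (simp add: \<beta>_simple B)
    next
      case True
      have "coroot K (\<beta> p) = simple_coroot K q + simple_coroot K p"
        unfolding \<beta>_p coroot_reflection[OF assms(2)] coreflection_def
        by (simp add: cartan_matrix a_qp)
      moreover have "\<beta> j (h + h') = \<beta> j h + \<beta> j h'" for h h'
        by (cases "j = p") (simp_all add: \<beta>_p_eq \<beta>_simple simple_root_add distrib_left)
      ultimately have "\<beta> j (coroot K (\<beta> p)) = \<beta> j (simple_coroot K q) + \<beta> j (simple_coroot K p)"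
        by simp
      then show ?thesis
        \<comment> \<open>For j = p this is (a_qq + c a_qp) + (a_pq + c a_pp) = (2 - c) + (-c + 2c)
          = 2.\<close>
        using True unfolding pair by (cases "j = p") (simp_all add: B diag a_pq a_qp)
    qed
  qed
  ultimately have "has_type K \<beta> B"
    unfolding has_type_def by blast
  then show ?thesis
    using \<beta>_p_eq pi B B_pq by auto
qed

end
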